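(* Every $n$-element point set in general position in the plane $\mathbb{R}^2$ has $\Omega(3^n)$ peeling sequences; that is, there is an absolute constant $c>0$ such that for every positive integer $n$, every set of $n$ points in general position in the plane has at least $c \cdot 3^n$ peeling sequences. On the other hand, for every integer $n \ge 3$ there is a set of $n$ points in general position in the plane that has at most $12.29^{n}/100$ peeling sequences.
   Context: A set of points in the plane is in general position if no three of its points are collinear. Let $P$ be a finite set of $n$ (labeled) points in the plane in general position. Consider the process that removes the points of $P$ one by one until no point remains, where in each step exactly one extreme point, i.e. one vertex of the convex hull of the set of currently remaining points, is removed. A peeling sequence of $P$ is a permutation $(p_1,\dots,p_n)$ of the points of $P$ obtained by listing the points in the order of their removal in such a process; i.e. for each $i$, $p_i$ is an extreme point of $\{p_i, p_{i+1},\dots,p_n\}$ (equivalently, $p_i \notin \mathrm{conv}\{p_{i+1},\dots,p_n\}$). *)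

theory Defs
  imports "HOL-Analysis.Analysis" "HOL-Combinatorics.Multiset_Permutations"
begin

definition general_position :: "(real^2) set \<Rightarrow> bool" where
  "general_position P \<longleftrightarrow>
     (\<forall>a\<in>P. \<forall>b\<in>P. \<forall>c\<in>P. a \<noteq> b \<and> a \<noteq> c \<and> b \<noteq> c \<longrightarrow> \<not> collinear {a, b, c})"

(* Positions are counted from 0, so drop i ps lists the points still present
   just before ps ! i is removed.  The convex hull is essential: extreme_point_of
   applied to the finite point set itself would only exclude points lying on a
   segment between two of the given points. *)
definition peeling_sequences :: "(real^2) set \<Rightarrow> (real^2) list set" where
  "peeling_sequences P =
     {ps \<in> permutations_of_set P.
        \<forall>i < length ps. (ps ! i) extreme_point_of (convex hull (set (drop i ps)))}"

end

theory Submission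
  imports Defs
begin

text \<open>
  For the lower bound, a set of at least three points in general position has at least three
  hull vertices, so each additional point multiplies the number of peeling sequences by at least 3.

  For the upper bound, write \<open>g Q\<close> for the number of peeling sequences of \<open>Q\<close>. By recursion on \<open>n\<close>
  we construct \<open>P\<close> with \<open>n\<close> points such that \<open>10 * g Q \<le> 5 ^ n * 2 ^ card Q\<close> for all nonempty
  \<open>Q \<subseteq> P\<close>. The set \<open>P\<close> consists of three flattened affine copies of smaller such sets, placed along
  three rays that positively span the plane. As long as all three arms are nonempty, every arm has
  only one hull vertex, so the next point can be chosen in at most three ways. Once an arm is used
  up, the other two are peeled in an arbitrary interleaving, which costs a factor of at most
  \<open>2 ^ m\<close> for \<open>m\<close> remaining points. With \<open>p\<close>, \<open>q\<close>, \<open>r\<close> points left in the arms, the count is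
  controlled by \<open>4 ^ (p + q) * 2 ^ r\<close>, which is preserved by the peeling recursion because
  \<open>1/4 + 1/4 + 1/2 = 1\<close>. For \<open>Q = P\<close> one gets \<open>10 ^ n / 10\<close>, which suffices for \<open>n \<ge> 12\<close>; for
  smaller \<open>n\<close> the trivial bound \<open>n!\<close> is enough.
\<close>

section \<open>Recursion for peeling sequences\<close>

text \<open>Extremality is phrased by deleting the point, because this form passes directly to
  subsets and to affine images; for finite sets it agrees with \<open>extreme_point_of\<close> the
  convex hull.\<close>

definition hull_vertices :: "(real^2) set \<Rightarrow> (real^2) set" where
  "hull_vertices Q = {x \<in> Q. x \<notin> convex hull (Q - {x})}"

lemma extreme_point_of_convex_hull_iff:
  fixes Q :: "(real^2) set"
  assumes "finite Q"
  shows "x extreme_point_of (convex hull Q) \<longleftrightarrow> x \<in> hull_vertices Q"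
proof
  assume ext: "x extreme_point_of (convex hull Q)"
  then have xQ: "x \<in> Q" by (rule extreme_point_of_convex_hull)
  have "convex (convex hull Q - {x})"
    using ext by (simp add: extreme_point_of_stillconvex)
  moreover have "Q - {x} \<subseteq> convex hull Q - {x}" using hull_subset[of Q convex] by auto
  ultimately have "convex hull (Q - {x}) \<subseteq> convex hull Q - {x}" by (rule hull_minimal[rotated])
  with xQ show "x \<in> hull_vertices Q" by (auto simp: hull_vertices_def)
next
  assume "x \<in> hull_vertices Q"
  then have "x \<in> Q" "x \<notin> convex hull (Q - {x})" by (auto simp: hull_vertices_def)
  then show "x extreme_point_of (convex hull Q)"
    using extreme_point_of_convex_hull_insert[of "Q - {x}" x] assms by (simp add: insert_absorb)
qed

lemma hull_vertices_subset: "hull_vertices Q \<subseteq> Q"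
  by (auto simp: hull_vertices_def)

lemma finite_hull_vertices [simp]: "finite Q \<Longrightarrow> finite (hull_vertices Q)"
  using finite_subset hull_vertices_subset by blast

text \<open>Fewer points span a smaller hull, so a vertex stays a vertex when other points
  disappear. Hence each part of a point set is itself peeled legally during a peeling of the
  whole.\<close>

lemma hull_vertices_antimono:
  assumes "Q \<subseteq> P"
  shows "hull_vertices P \<inter> Q \<subseteq> hull_vertices Q"
  using hull_mono[of "Q - {_}" "P - {_}" convex] assms unfolding hull_vertices_def by blast

lemma convex_hull_hull_vertices:
  assumes "finite Q"
  shows "convex hull (hull_vertices Q) = convex hull Q"
proof -
  have "convex hull Q = convex hull {x. x extreme_point_of (convex hull Q)}"
    using assms by (intro Krein_Milman_Minkowski) (auto intro: finite_imp_compact_convex_hull)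
  then show ?thesis using extreme_point_of_convex_hull_iff[OF assms] by simp
qed

lemma finite_peeling_sequences [simp]: "finite (peeling_sequences Q)"
  by (simp add: peeling_sequences_def)

lemma peeling_sequences_empty [simp]: "peeling_sequences {} = {[]}"
  by (auto simp: peeling_sequences_def)

text \<open>The first removed point can be any hull vertex, and what follows is exactly a peeling
  sequence of the rest. All counting below is induction along this recursion.\<close>

lemma peeling_sequences_rec:
  assumes "finite Q" "Q \<noteq> {}"
  shows "peeling_sequences Q = (\<Union>x\<in>hull_vertices Q. (#) x ` peeling_sequences (Q - {x}))"
proof -
  have step: "x # ps \<in> peeling_sequences Q \<longleftrightarrow>
      x \<in> hull_vertices Q \<and> ps \<in> peeling_sequences (Q - {x})" for x ps
  proof -
    have perm: "x # ps \<in> permutations_of_set Q \<longleftrightarrow> x \<in> Q \<and> ps \<in> permutations_of_set (Q - {x})"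
      using assms by (subst permutations_of_set_nonempty) auto
    have "set (x # ps) = Q" if "x # ps \<in> permutations_of_set Q"
      using that permutations_of_setD(1) by blast
    then show ?thesis
      unfolding peeling_sequences_def
      using perm extreme_point_of_convex_hull_iff[OF assms(1)] hull_vertices_subset[of Q]
      \<comment> \<open>Position 0 is the condition on \<open>x\<close>; position
        \<open>Suc i\<close> of \<open>x # ps\<close> sees the same remaining points as position
        \<open>i\<close> of \<open>ps\<close>.\<close>
      by (auto simp: All_less_Suc2)
  qed
  have "ps \<noteq> []" if "ps \<in> peeling_sequences Q" for ps
    using that assms by (auto simp: peeling_sequences_def permutations_of_set_def)
  then show ?thesis
    using step by (auto simp: image_iff) (metis list.exhaust)
qed

lemma card_peeling_sequences_rec:
  assumes "finite Q" "Q \<noteq> {}"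
  shows "card (peeling_sequences Q) = (\<Sum>x\<in>hull_vertices Q. card (peeling_sequences (Q - {x})))"
  unfolding peeling_sequences_rec[OF assms]
  by (subst card_UN_disjoint) (use assms in \<open>auto simp: card_image\<close>)

lemma hull_vertices_nonempty:
  assumes "finite Q" "Q \<noteq> {}"
  shows "hull_vertices Q \<noteq> {}"
  using convex_hull_hull_vertices[OF assms(1)] assms(2) by (metis convex_hull_eq_empty)

lemma card_peeling_sequences_pos:
  assumes "finite Q"
  shows "card (peeling_sequences Q) > 0"
  using assms
proof (induction "card Q" arbitrary: Q rule: less_induct)
  case less
  show ?case
  proof (cases "Q = {}")
    case False
    then obtain x where x: "x \<in> hull_vertices Q"
      using hull_vertices_nonempty less.prems by blast
    with hull_vertices_subset have "x \<in> Q" by blast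
    then have "card (peeling_sequences (Q - {x})) > 0"
      using less by (metis card_Diff1_less finite_Diff)
    then show ?thesis
      using x less.prems False by (auto simp: card_peeling_sequences_rec sum_pos2)
  qed simp
qed

lemma card_peeling_sequences_le_fact:
  "finite Q \<Longrightarrow> card (peeling_sequences Q) \<le> fact (card Q)"
  unfolding peeling_sequences_def
  by (subst card_permutations_of_set[symmetric], assumption, rule card_mono) auto

section \<open>The lower bound\<close>

lemma general_position_subset: "general_position P \<Longrightarrow> Q \<subseteq> P \<Longrightarrow> general_position Q"
  by (auto simp: general_position_def)

text \<open>With at most two hull vertices the convex hull would be a segment, which would make any
  three of the points collinear.\<close>

lemma card_hull_vertices_ge_3:
  assumes "finite Q" "general_position Q" "card Q \<ge> 3"
  shows "card (hull_vertices Q) \<ge> 3"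
proof (rule ccontr)
  assume "\<not> ?thesis"
  moreover have "Q \<noteq> {}" using assms(3) by auto
  then have "card (hull_vertices Q) > 0"
    using assms(1) hull_vertices_nonempty by (simp add: card_gt_0_iff)
  ultimately have "card (hull_vertices Q) = 1 \<or> card (hull_vertices Q) = 2" by linarith
  \<comment> \<open>The points \<open>a\<close> and \<open>b\<close> may coincide, which covers the
    case of a single vertex.\<close>
  then obtain a b where "hull_vertices Q \<subseteq> {a, b}"
    by (auto simp: card_1_singleton_iff card_2_iff)
  then have "convex hull Q \<subseteq> convex hull {a, b}"
    using convex_hull_hull_vertices[OF assms(1)] hull_mono by metis
  then have Q: "Q \<subseteq> closed_segment a b"
    using hull_subset[of Q convex] by (auto simp: segment_convex_hull)
  from assms(3) obtain x y z where "x \<in> Q" "y \<in> Q" "z \<in> Q" "x \<noteq> y" "x \<noteq> z" "y \<noteq> z"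
    using card_le_Suc_iff[of 2 Q] card_le_Suc_iff[of 1] card_le_Suc_iff[of 0]
    by (auto simp: numeral_3_eq_3 numeral_2_eq_2 card_le_Suc_iff)
  with Q show False
    using assms(2) collinear_subset[OF collinear_closed_segment, of "{x, y, z}" a b]
    unfolding general_position_def by blast
qed

text \<open>The factor 9 absorbs the start of the induction: up to two points there is at least one
  sequence and \<open>3 ^ card P\<close> is at most 9. From three points on, each removal offers at
  least three choices.\<close>

lemma card_peeling_sequences_lower:
  assumes "finite P" "general_position P"
  shows "3 ^ card P \<le> 9 * card (peeling_sequences P)"
  using assms
proof (induction "card P" arbitrary: P rule: less_induct)
  case less
  show ?case
  proof (cases "card P \<ge> 3")
    case False
    then have "(3::nat) ^ card P \<le> 3 ^ 2" by (intro power_increasing) auto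
    moreover have "card (peeling_sequences P) \<ge> 1"
      using card_peeling_sequences_pos less.prems by (simp add: Suc_leI)
    ultimately show ?thesis by simp
  next
    case True
    have IH: "3 ^ (card P - 1) \<le> 9 * card (peeling_sequences (P - {x}))" if "x \<in> P" for x
      using less.hyps[of "P - {x}"] that less.prems True
      by (simp add: card_Diff_singleton_if general_position_subset)
    have "3 ^ card P = 3 * (3::nat) ^ (card P - 1)"
      using True by (subst power_Suc[symmetric]) simp
    also have "\<dots> \<le> card (hull_vertices P) * 3 ^ (card P - 1)"
      using card_hull_vertices_ge_3 less.prems True by (intro mult_right_mono) auto
    also have "\<dots> = (\<Sum>x\<in>hull_vertices P. 3 ^ (card P - 1))" by simp
    also have "\<dots> \<le> (\<Sum>x\<in>hull_vertices P. 9 * card (peeling_sequences (P - {x})))"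
      using IH hull_vertices_subset[of P] by (intro sum_mono) blast
    also have "\<dots> = 9 * card (peeling_sequences P)"
      using True less.prems by (subst card_peeling_sequences_rec) (auto simp: sum_distrib_left)
    finally show ?thesis .
  qed
qed

section \<open>Interleaving two point sets\<close>

text \<open>A peeling sequence of the union induces one of \<open>A\<close> and one of
  \<open>B\<close>, and the power of 2 bounds the number of ways to interleave them.\<close>

lemma card_peeling_sequences_Un_le:
  assumes "finite A" "finite B" "A \<inter> B = {}"
  shows "card (peeling_sequences (A \<union> B)) \<le>
    2 ^ (card A + card B) * (card (peeling_sequences A) * card (peeling_sequences B))"
  using assms
proof (induction "card A + card B" arbitrary: A B rule: less_induct)
  case less
  let ?g = "\<lambda>Q. card (peeling_sequences Q)"
  let ?N = "2 ^ (card A + card B) * (?g A * ?g B)"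
  let ?V = "hull_vertices (A \<union> B)"
  \<comment> \<open>Each removal lowers the exponent of 2 by one, so the sequences that start in one
    given side make up at most half of the bound. The disjunction treats both sides at once.\<close>
  have half: "2 * (\<Sum>x\<in>?V \<inter> X. ?g (A \<union> B - {x})) \<le> ?N"
    if X: "X = A \<and> Y = B \<or> X = B \<and> Y = A" for X Y
  proof (cases "X = {}")
    case False
    have fin: "finite X" "finite Y" and disj: "X \<inter> Y = {}" and U: "A \<union> B = X \<union> Y"
      using X less.prems by auto
    have V: "?V \<inter> X \<subseteq> hull_vertices X"
      using hull_vertices_antimono[of X "A \<union> B"] U by auto
    have bound: "2 * ?g (A \<union> B - {x}) \<le> 2 ^ (card X + card Y) * (?g (X - {x}) * ?g Y)"
      if "x \<in> X" for x
    proof -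
      have xY: "A \<union> B - {x} = (X - {x}) \<union> Y" using U that disj by auto
      have c: "card X = Suc (card (X - {x}))" using that fin by (metis card_Suc_Diff1)
      have "?g ((X - {x}) \<union> Y) \<le> 2 ^ (card (X - {x}) + card Y) * (?g (X - {x}) * ?g Y)"
        using less.hyps[of "X - {x}" Y] X c fin disj by fastforce
      then show ?thesis using c xY by simp
    qed
    have "2 * (\<Sum>x\<in>?V \<inter> X. ?g (A \<union> B - {x})) \<le>
        (\<Sum>x\<in>?V \<inter> X. 2 ^ (card X + card Y) * (?g (X - {x}) * ?g Y))"
      unfolding sum_distrib_left by (intro sum_mono bound) auto
    also have "\<dots> \<le> (\<Sum>x\<in>hull_vertices X. 2 ^ (card X + card Y) * (?g (X - {x}) * ?g Y))"
      using V fin by (intro sum_mono2) auto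
    also have "\<dots> = 2 ^ (card X + card Y) * (?g X * ?g Y)"
      using fin False by (simp add: card_peeling_sequences_rec sum_distrib_left sum_distrib_right)
    finally show ?thesis using X by (auto simp: ac_simps)
  qed simp
  show ?case
  proof (cases "A \<union> B = {}")
    case False
    have "?g (A \<union> B) = (\<Sum>x\<in>?V. ?g (A \<union> B - {x}))"
      using less.prems False by (intro card_peeling_sequences_rec) auto
    also have "?V = (?V \<inter> A) \<union> (?V \<inter> B)" using hull_vertices_subset[of "A \<union> B"] by blast
    also have "(\<Sum>x\<in>\<dots>. ?g (A \<union> B - {x})) =
        (\<Sum>x\<in>?V \<inter> A. ?g (A \<union> B - {x})) + (\<Sum>x\<in>?V \<inter> B. ?g (A \<union> B - {x}))"
      using less.prems by (intro sum.union_disjoint) auto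
    finally show ?thesis using half[of A B] half[of B A] by simp
  qed simp
qed

section \<open>Counting in three shielded arms\<close>

text \<open>All subsets are included because an arm may be partly used up when the other arms are
  considered. The empty set has one peeling sequence and would violate the bound if \<open>P\<close>
  had at most one point. The factor 10 is the slack that later pays for adding three
  summands.\<close>

definition economical :: "(real^2) set \<Rightarrow> bool" where
  "economical P \<longleftrightarrow> finite P \<and> general_position P \<and>
     (\<forall>Q\<subseteq>P. Q \<noteq> {} \<longrightarrow> 10 * card (peeling_sequences Q) \<le> 5 ^ card P * 2 ^ card Q)"

lemma economical_finite: "economical P \<Longrightarrow> finite P"
  by (simp add: economical_def)

lemma economical_bound:
  "economical P \<Longrightarrow> Q \<subseteq> P \<Longrightarrow> Q \<noteq> {} \<Longrightarrow>
    10 * card (peeling_sequences Q) \<le> 5 ^ card P * 2 ^ card Q"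
  by (simp add: economical_def)

section \<open>Invariance under injective affine maps\<close>

lemma hull_vertices_affine_image:
  assumes "linear L" "inj L"
  shows "hull_vertices ((\<lambda>x. v + L x) ` Q) = (\<lambda>x. v + L x) ` hull_vertices Q"
proof -
  let ?f = "\<lambda>x. v + L x"
  have inj: "inj ?f" using assms(2) by (auto simp: inj_def)
  have hull: "convex hull (?f ` S) = ?f ` (convex hull S)" for S
    using convex_hull_translation[of v "L ` S"] convex_hull_linear_image[OF assms(1), of S, symmetric]
    by (simp add: image_image)
  have "?f ` Q - {?f x} = ?f ` (Q - {x})" for x
    using inj by (auto simp: inj_def)
  then show ?thesis
    unfolding hull_vertices_def
    by (auto simp: hull inj_image_mem_iff[OF inj] simp del: add_left_cancel)
qed

lemma card_peeling_sequences_affine_image: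
  assumes "linear L" "inj L" "finite Q"
  shows "card (peeling_sequences ((\<lambda>x. v + L x) ` Q)) = card (peeling_sequences Q)"
  using assms(3)
proof (induction "card Q" arbitrary: Q rule: less_induct)
  case less
  let ?f = "\<lambda>x. v + L x"
  have inj: "inj ?f" using assms(2) by (auto simp: inj_def)
  show ?case
  proof (cases "Q = {}")
    case False
    have "card (peeling_sequences (?f ` Q)) =
        (\<Sum>x\<in>hull_vertices Q. card (peeling_sequences (?f ` Q - {?f x})))"
      using less.prems False inj_on_subset[OF inj]
      by (simp add: card_peeling_sequences_rec hull_vertices_affine_image[OF assms(1,2)] sum.reindex)
    also have "\<dots> = (\<Sum>x\<in>hull_vertices Q. card (peeling_sequences (Q - {x})))"
    proof (rule sum.cong[OF refl])
      fix x assume "x \<in> hull_vertices Q"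
      then have "x \<in> Q" using hull_vertices_subset by blast
      moreover have "?f ` Q - {?f x} = ?f ` (Q - {x})"
        using inj by (auto simp: inj_def)
      ultimately show "card (peeling_sequences (?f ` Q - {?f x})) = card (peeling_sequences (Q - {x}))"
        using less by (metis card_Diff1_less finite_Diff)
    qed
    finally show ?thesis using less.prems False by (simp add: card_peeling_sequences_rec)
  qed simp
qed

lemma general_position_affine_image:
  assumes "linear L" "inj L" "general_position P"
  shows "general_position ((\<lambda>x. v + L x) ` P)"
proof -
  have "collinear {a, b, c}" if "collinear {v + L a, v + L b, v + L c}" for a b c
  proof -
    \<comment> \<open>Collinearity is an affine relation with coefficients \<open>u\<close> and
      \<open>1 - u\<close>, and an injective affine map can be cancelled from it.\<close>
    have "a = c \<or> (\<exists>u. v + L b = u *\<^sub>R (v + L a) + (1 - u) *\<^sub>R (v + L c))"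
      using that assms(2) by (auto simp: collinear_3_expand inj_def)
    moreover have "u *\<^sub>R (v + L a) + (1 - u) *\<^sub>R (v + L c) = v + L (u *\<^sub>R a + (1 - u) *\<^sub>R c)" for u
      by (simp add: linear_add[OF assms(1)] linear_diff[OF assms(1)] linear_scale[OF assms(1)]
          algebra_simps)
    ultimately show ?thesis
      using assms(2) by (auto simp: collinear_3_expand inj_def)
  qed
  then show ?thesis
    using assms(3) by (simp add: general_position_def) metis
qed

lemma economical_affine_image:
  assumes "linear L" "inj L" "economical P"
  shows "economical ((\<lambda>x. v + L x) ` P)" "card ((\<lambda>x. v + L x) ` P) = card P"
proof -
  let ?f = "\<lambda>x. v + L x"
  have inj: "inj_on ?f S" for S using assms(2) by (auto simp: inj_def inj_on_def)
  show card: "card (?f ` P) = card P" by (rule card_image[OF inj])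
  have "10 * card (peeling_sequences Q) \<le> 5 ^ card (?f ` P) * 2 ^ card Q"
    if Q: "Q \<subseteq> ?f ` P" "Q \<noteq> {}" for Q
  proof -
    obtain S where S: "S \<subseteq> P" "Q = ?f ` S" using Q(1) by (rule subset_imageE)
    have "finite S" using S(1) economical_finite[OF assms(3)] by (rule finite_subset)
    then show ?thesis
      using S Q assms card card_image[OF inj, of S]
      by (auto simp: card_peeling_sequences_affine_image economical_def)
  qed
  moreover have "finite (?f ` P)" "general_position (?f ` P)"
    using assms by (simp_all add: economical_def general_position_affine_image)
  ultimately show "economical (?f ` P)" by (simp add: economical_def)
qed

section \<open>Peeling three mutually shielded sets\<close>

text \<open>Asking for every \<open>y\<close> and \<open>z\<close> makes the property survive the
  removal of points: one remaining point in each of the other two arms is enough.\<close>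

definition shielded :: "(real^2) set \<Rightarrow> (real^2) set \<Rightarrow> (real^2) set \<Rightarrow> bool" where
  "shielded X Y Z \<longleftrightarrow> (\<forall>x\<in>X. \<forall>x'\<in>X. \<forall>y\<in>Y. \<forall>z\<in>Z. x \<noteq> x' \<longrightarrow>
     x \<in> convex hull {x', y, z} \<or> x' \<in> convex hull {x, y, z})"

lemma shielded_subset:
  "shielded X Y Z \<Longrightarrow> X' \<subseteq> X \<Longrightarrow> Y' \<subseteq> Y \<Longrightarrow> Z' \<subseteq> Z \<Longrightarrow> shielded X' Y' Z'"
  unfolding shielded_def by blast

text \<open>Of two points of \<open>X\<close>, one lies in a triangle formed by the other and a
  point of each of \<open>Y\<close> and \<open>Z\<close>, so it is not a hull vertex.\<close>

lemma card_hull_vertices_shielded: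
  assumes "shielded X Y Z" "finite X" "X \<inter> Y = {}" "X \<inter> Z = {}" "Y \<noteq> {}" "Z \<noteq> {}"
    "X \<union> Y \<union> Z \<subseteq> Q"
  shows "card (hull_vertices Q \<inter> X) \<le> 1"
proof -
  have "x = x'" if "x \<in> hull_vertices Q \<inter> X" "x' \<in> hull_vertices Q \<inter> X" for x x'
  proof (rule ccontr)
    assume ne: "x \<noteq> x'"
    obtain y z where yz: "y \<in> Y" "z \<in> Z" using assms by blast
    have "{x', y, z} \<subseteq> Q - {x}" "{x, y, z} \<subseteq> Q - {x'}" using that yz ne assms by auto
    then have "convex hull {x', y, z} \<subseteq> convex hull (Q - {x})"
      "convex hull {x, y, z} \<subseteq> convex hull (Q - {x'})" by (auto intro!: hull_mono)
    with that yz ne assms(1) show False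
      unfolding shielded_def hull_vertices_def by blast
  qed
  then show ?thesis
    using assms(2) by (auto simp: card_le_Suc0_iff_eq)
qed

text \<open>The base 4 is a factor 2 for the interleaving times a factor 2 from the bound for each
  arm, and 100 is the product of the two factors 10.\<close>

lemma economical_two_arms:
  assumes A: "economical A" "X \<subseteq> A" "X \<noteq> {}" and B: "economical B" "Y \<subseteq> B" "Y \<noteq> {}"
    and disj: "A \<inter> B = {}"
  shows "100 * card (peeling_sequences (X \<union> Y)) \<le> 5 ^ (card A + card B) * 4 ^ (card X + card Y)"
proof -
  let ?g = "\<lambda>Q. card (peeling_sequences Q)"
  have fin: "finite X" "finite Y"
    using A(2) B(2) economical_finite[OF A(1)] economical_finite[OF B(1)] by (auto intro: finite_subset)
  have "X \<inter> Y = {}" using A B disj by blast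
  then have "100 * ?g (X \<union> Y) \<le> 2 ^ (card X + card Y) * ((10 * ?g X) * (10 * ?g Y))"
    using card_peeling_sequences_Un_le[OF fin] by simp
  also have "\<dots> \<le> 2 ^ (card X + card Y) * ((5 ^ card A * 2 ^ card X) * (5 ^ card B * 2 ^ card Y))"
    by (rule mult_le_mono2[OF mult_le_mono[OF economical_bound[OF A] economical_bound[OF B]]])
  also have "\<dots> = 5 ^ (card A + card B) * 4 ^ (card X + card Y)"
  proof -
    have "(4::nat) ^ (card X + card Y) = 2 ^ (card X + card Y) * 2 ^ (card X + card Y)"
      by (simp flip: power_mult_distrib)
    then show ?thesis by (simp add: power_add ac_simps)
  qed
  finally show ?thesis .
qed

text \<open>One summand for each arm that may be the first to be used up.\<close>
definition weight :: "nat \<Rightarrow> nat \<Rightarrow> nat \<Rightarrow> nat \<Rightarrow> nat \<Rightarrow> nat \<Rightarrow> nat" where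
  "weight a b c p q r =
     5 ^ (a + b) * 4 ^ (p + q) * 2 ^ r +
     5 ^ (b + c) * 4 ^ (q + r) * 2 ^ p +
     5 ^ (c + a) * 4 ^ (r + p) * 2 ^ q"

text \<open>In each summand, removing a point from an arm with base 4 leaves a quarter, and from the
  arm with base 2 a half; the three removals together give back the whole.\<close>

lemma weight_Suc:
  "weight a b c p (Suc q) (Suc r) + weight a b c (Suc p) q (Suc r) + weight a b c (Suc p) (Suc q) r =
   weight a b c (Suc p) (Suc q) (Suc r)"
  by (simp add: weight_def algebra_simps)

text \<open>When an arm runs out, the summand in which it has base 2 is exactly the bound for the
  other two arms.\<close>

lemma weight_empty_arm:
  "5 ^ (a + b) * 4 ^ (p + q) \<le> weight a b c p q 0"
  "5 ^ (b + c) * 4 ^ (q + r) \<le> weight a b c 0 q r"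
  "5 ^ (c + a) * 4 ^ (r + p) \<le> weight a b c p 0 r"
  by (simp_all add: weight_def)

text \<open>While all arms are nonempty, each offers at most one vertex, and the three resulting
  bounds add up by \<open>weight_Suc\<close>. The recursion stops at the first empty arm, so two
  nonempty arms are always left.\<close>

lemma card_peeling_sequences_three_arms:
  assumes econ: "economical A" "economical B" "economical C"
    and disj: "A \<inter> B = {}" "B \<inter> C = {}" "C \<inter> A = {}"
    and shield: "shielded A B C" "shielded B C A" "shielded C A B"
    and sub: "X \<subseteq> A" "Y \<subseteq> B" "Z \<subseteq> C"
    and two: "X \<noteq> {} \<or> Y \<noteq> {}" "Y \<noteq> {} \<or> Z \<noteq> {}" "Z \<noteq> {} \<or> X \<noteq> {}"
  shows "100 * card (peeling_sequences (X \<union> Y \<union> Z)) \<le>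
    weight (card A) (card B) (card C) (card X) (card Y) (card Z)"
  using sub two
proof (induction "card X + card Y + card Z" arbitrary: X Y Z rule: less_induct)
  case less
  let ?g = "\<lambda>Q. card (peeling_sequences Q)"
  let ?W = "weight (card A) (card B) (card C)"
  have fin: "finite X" "finite Y" "finite Z"
    using less.prems(1-3) econ[THEN economical_finite] by (auto intro: finite_subset)
  consider "X = {}" | "Y = {}" | "Z = {}" | "X \<noteq> {}" "Y \<noteq> {}" "Z \<noteq> {}" by blast
  then show ?case
  proof cases
    case 1
    then have "100 * ?g (Y \<union> Z) \<le> 5 ^ (card B + card C) * 4 ^ (card Y + card Z)"
      using less.prems econ disj by (intro economical_two_arms) auto
    also have "\<dots> \<le> ?W 0 (card Y) (card Z)" by (rule weight_empty_arm)
    finally show ?thesis using 1 by simp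
  next
    case 2
    then have "100 * ?g (Z \<union> X) \<le> 5 ^ (card C + card A) * 4 ^ (card Z + card X)"
      using less.prems econ disj by (intro economical_two_arms) auto
    also have "\<dots> \<le> ?W (card X) 0 (card Z)" by (rule weight_empty_arm)
    finally show ?thesis using 2 by (simp add: Un_commute)
  next
    case 3
    then have "100 * ?g (X \<union> Y) \<le> 5 ^ (card A + card B) * 4 ^ (card X + card Y)"
      using less.prems econ disj by (intro economical_two_arms) auto
    also have "\<dots> \<le> ?W (card X) (card Y) 0" by (rule weight_empty_arm)
    finally show ?thesis using 3 by simp
  next
    case 4
    define Q where "Q = X \<union> Y \<union> Z"
    let ?V = "hull_vertices Q"
    have dXYZ: "X \<inter> Y = {}" "Y \<inter> Z = {}" "Z \<inter> X = {}" using less.prems disj by auto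
    obtain p q r where pqr: "card X = Suc p" "card Y = Suc q" "card Z = Suc r"
      using 4 fin by (metis card_0_eq not0_implies_Suc)
    \<comment> \<open>The sum has at most one term, so a bound for a single removal bounds the whole
      contribution of an arm.\<close>
    have one: "100 * (\<Sum>x\<in>?V \<inter> S. ?g (Q - {x})) \<le> w"
      if "card (?V \<inter> S) \<le> 1" "\<And>x. x \<in> S \<Longrightarrow> 100 * ?g (Q - {x}) \<le> w" for S w
    proof -
      have "100 * (\<Sum>x\<in>?V \<inter> S. ?g (Q - {x})) \<le> (\<Sum>x\<in>?V \<inter> S. w)"
        unfolding sum_distrib_left using that by (intro sum_mono) auto
      also have "\<dots> \<le> w" using that(1) by simp
      finally show ?thesis .
    qed
    have X: "100 * (\<Sum>x\<in>?V \<inter> X. ?g (Q - {x})) \<le> ?W p (Suc q) (Suc r)"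
    proof (rule one)
      show "card (?V \<inter> X) \<le> 1"
        using shielded_subset[OF shield(1) less.prems(1-3)] fin dXYZ 4
        by (intro card_hull_vertices_shielded[of X Y Z]) (auto simp: Q_def)
      show "100 * ?g (Q - {x}) \<le> ?W p (Suc q) (Suc r)" if "x \<in> X" for x
      proof -
        have "Q - {x} = (X - {x}) \<union> Y \<union> Z" "card (X - {x}) = p"
          using that dXYZ pqr fin by (auto simp: Q_def)
        then show ?thesis using less.hyps[of "X - {x}" Y Z] less.prems 4 pqr by auto
      qed
    qed
    have Y: "100 * (\<Sum>x\<in>?V \<inter> Y. ?g (Q - {x})) \<le> ?W (Suc p) q (Suc r)"
    proof (rule one)
      show "card (?V \<inter> Y) \<le> 1"
        using shielded_subset[OF shield(2) less.prems(2,3,1)] fin dXYZ 4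
        by (intro card_hull_vertices_shielded[of Y Z X]) (auto simp: Q_def)
      show "100 * ?g (Q - {x}) \<le> ?W (Suc p) q (Suc r)" if "x \<in> Y" for x
      proof -
        have "Q - {x} = X \<union> (Y - {x}) \<union> Z" "card (Y - {x}) = q"
          using that dXYZ pqr fin by (auto simp: Q_def)
        then show ?thesis using less.hyps[of X "Y - {x}" Z] less.prems 4 pqr by auto
      qed
    qed
    have Z: "100 * (\<Sum>x\<in>?V \<inter> Z. ?g (Q - {x})) \<le> ?W (Suc p) (Suc q) r"
    proof (rule one)
      show "card (?V \<inter> Z) \<le> 1"
        using shielded_subset[OF shield(3) less.prems(3,1,2)] fin dXYZ 4
        by (intro card_hull_vertices_shielded[of Z X Y]) (auto simp: Q_def)
      show "100 * ?g (Q - {x}) \<le> ?W (Suc p) (Suc q) r" if "x \<in> Z" for x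
      proof -
        have "Q - {x} = X \<union> Y \<union> (Z - {x})" "card (Z - {x}) = r"
          using that dXYZ pqr fin by (auto simp: Q_def)
        then show ?thesis using less.hyps[of X Y "Z - {x}"] less.prems 4 pqr by auto
      qed
    qed
    have "?g Q = (\<Sum>x\<in>?V. ?g (Q - {x}))"
      using fin 4 by (intro card_peeling_sequences_rec) (auto simp: Q_def)
    also have "?V = (?V \<inter> X) \<union> (?V \<inter> Y) \<union> (?V \<inter> Z)"
      using hull_vertices_subset[of Q] by (auto simp: Q_def)
    also have "(\<Sum>x\<in>\<dots>. ?g (Q - {x})) = (\<Sum>x\<in>?V \<inter> X. ?g (Q - {x})) +
        (\<Sum>x\<in>?V \<inter> Y. ?g (Q - {x})) + (\<Sum>x\<in>?V \<inter> Z. ?g (Q - {x}))"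
      using fin dXYZ by (subst sum.union_disjoint; (subst sum.union_disjoint)?) auto
    finally have "100 * ?g Q \<le> ?W p (Suc q) (Suc r) + ?W (Suc p) q (Suc r) + ?W (Suc p) (Suc q) r"
      using X Y Z by simp
    then show ?thesis unfolding weight_Suc pqr Q_def .
  qed
qed

lemma economical_subset_bound:
  assumes "economical A" "X \<subseteq> A" "X \<noteq> {}" "card A \<le> n"
  shows "10 * card (peeling_sequences X) \<le> 5 ^ n * 2 ^ card X"
proof -
  have "10 * card (peeling_sequences X) \<le> 5 ^ card A * 2 ^ card X"
    using assms(1-3) by (rule economical_bound)
  also have "\<dots> \<le> 5 ^ n * 2 ^ card X" using assms(4) by (simp add: power_increasing)
  finally show ?thesis .
qed

text \<open>The balance conditions make each summand of \<open>weight\<close> at most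
  \<open>10 / 3\<close> times the target, so 100 times the count is at most 10 times the target. A
  subset of a single arm inherits the bound of that arm.\<close>

lemma economical_Un:
  assumes econ: "economical A" "economical B" "economical C"
    and disj: "A \<inter> B = {}" "B \<inter> C = {}" "C \<inter> A = {}"
    and shield: "shielded A B C" "shielded B C A" "shielded C A B"
    and gp: "general_position (A \<union> B \<union> C)"
    and balanced: "3 * 2 ^ (card A + card B) \<le> 10 * (5::nat) ^ card C"
      "3 * 2 ^ (card B + card C) \<le> 10 * (5::nat) ^ card A"
      "3 * 2 ^ (card C + card A) \<le> 10 * (5::nat) ^ card B"
  shows "economical (A \<union> B \<union> C)" "card (A \<union> B \<union> C) = card A + card B + card C"
proof -
  let ?n = "card A + card B + card C"
  have fin: "finite A" "finite B" "finite C" using econ by (simp_all add: economical_finite)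
  show card: "card (A \<union> B \<union> C) = ?n"
    using fin disj by (subst card_Un_disjoint; (subst card_Un_disjoint)?) auto
  have "10 * card (peeling_sequences Q) \<le> 5 ^ ?n * 2 ^ card Q" if Q: "Q \<subseteq> A \<union> B \<union> C" "Q \<noteq> {}" for Q
  proof -
    define X Y Z where "X = Q \<inter> A" and "Y = Q \<inter> B" and "Z = Q \<inter> C"
    have sub: "X \<subseteq> A" "Y \<subseteq> B" "Z \<subseteq> C" and QU: "Q = X \<union> Y \<union> Z"
      using Q by (auto simp: X_def Y_def Z_def)
    have "finite X" "finite Y" "finite Z" using sub fin by (auto intro: finite_subset)
    then have cQ: "card Q = card X + card Y + card Z"
      unfolding QU using disj sub by (subst card_Un_disjoint; (subst card_Un_disjoint)?) auto
    consider "Q \<subseteq> A" | "Q \<subseteq> B" | "Q \<subseteq> C"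
      | "X \<noteq> {} \<or> Y \<noteq> {}" "Y \<noteq> {} \<or> Z \<noteq> {}" "Z \<noteq> {} \<or> X \<noteq> {}"
      using QU sub by blast
    then show ?thesis
    proof cases
      case 4
      \<comment> \<open>One factor \<open>2 ^ (p + q)\<close> of \<open>4 ^ (p + q)\<close> goes
        into the power for \<open>card Q\<close>; the other is paid for by \<open>5 ^ c\<close>, the
        power of 5 of the third arm.\<close>
      have third: "3 * (5 ^ (a + b) * 4 ^ (p + q) * 2 ^ r) \<le> 10 * (5 ^ (a + b + c) * (2::nat) ^ (p + q + r))"
        if "3 * 2 ^ (a + b) \<le> 10 * (5::nat) ^ c" "p \<le> a" "q \<le> b" for a b c p q r :: nat
      proof -
        have "3 * 2 ^ (p + q) \<le> 3 * (2::nat) ^ (a + b)"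
          using that by (intro mult_left_mono power_increasing) auto
        with that(1) have "3 * (2::nat) ^ (p + q) \<le> 10 * 5 ^ c" by linarith
        then have "5 ^ (a + b) * 2 ^ (p + q) * 2 ^ r * (3 * 2 ^ (p + q))
            \<le> 5 ^ (a + b) * 2 ^ (p + q) * 2 ^ r * (10 * (5::nat) ^ c)"
          by (rule mult_left_mono) simp
        moreover have "(4::nat) ^ (p + q) = 2 ^ (p + q) * 2 ^ (p + q)"
          by (simp flip: power_mult_distrib)
        ultimately show ?thesis by (simp add: power_add ac_simps)
      qed
      have le: "card X \<le> card A" "card Y \<le> card B" "card Z \<le> card C"
        using sub fin by (auto intro: card_mono)
      have "3 * weight (card A) (card B) (card C) (card X) (card Y) (card Z) \<le>
          30 * (5 ^ ?n * 2 ^ card Q)"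
        using third[OF balanced(1) le(1,2), of "card Z"] third[OF balanced(2) le(2,3), of "card X"]
          third[OF balanced(3) le(3,1), of "card Y"]
        by (simp add: weight_def cQ ac_simps)
      moreover have "100 * card (peeling_sequences Q) \<le>
          weight (card A) (card B) (card C) (card X) (card Y) (card Z)"
        unfolding QU using econ disj shield sub 4 by (rule card_peeling_sequences_three_arms)
      ultimately show ?thesis by linarith
    qed (use Q econ in \<open>auto intro: economical_subset_bound\<close>)
  qed
  then show "economical (A \<union> B \<union> C)"
    using fin gp card by (auto simp: economical_def)
qed

section \<open>Flattened arms\<close>

definition cross :: "real^2 \<Rightarrow> real^2 \<Rightarrow> real" where
  "cross u v = u $ 1 * v $ 2 - u $ 2 * v $ 1"

text \<open>Twice the signed area of the triangle, positive for counterclockwise order.\<close>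

definition orient :: "real^2 \<Rightarrow> real^2 \<Rightarrow> real^2 \<Rightarrow> real" where
  "orient a b c = cross (b - a) (c - a)"

lemma orient_rotate: "orient a b c = orient b c a"
  by (simp add: orient_def cross_def algebra_simps)

lemma orient_collinear: "collinear {a, b, c} \<Longrightarrow> orient a b c = 0"
proof (cases "a = c")
  case True
  then show ?thesis by (simp add: orient_def cross_def)
next
  case False
  assume "collinear {a, b, c}"
  with False obtain u where u: "b = u *\<^sub>R a + (1 - u) *\<^sub>R c" by (auto simp: collinear_3_expand)
  show ?thesis by (simp add: u orient_def cross_def algebra_simps)
qed

text \<open>The barycentric coordinates of \<open>p\<close> are the signed areas of the three
  subtriangles at \<open>p\<close> divided by the area of the whole triangle.\<close>

lemma in_triangle_if_orient_pos:
  assumes "orient p b c > 0" "orient a p c > 0" "orient a b p > 0"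
  shows "p \<in> convex hull {a, b, c}"
proof -
  define s where "s = orient a b c"
  have sum: "orient p b c + orient a p c + orient a b p = s"
    by (simp add: s_def orient_def cross_def algebra_simps)
  then have s: "s > 0" using assms by linarith
  have "s *\<^sub>R p = orient p b c *\<^sub>R a + orient a p c *\<^sub>R b + orient a b p *\<^sub>R c"
    by (simp add: s_def orient_def cross_def vec_eq_iff forall_2 algebra_simps)
  then have "p = (orient p b c / s) *\<^sub>R a + (orient a p c / s) *\<^sub>R b + (orient a b p / s) *\<^sub>R c"
    using s by (simp add: vec_eq_iff forall_2 field_simps)
  moreover have "orient p b c / s + orient a p c / s + orient a b p / s = 1"
    using s sum by (simp add: add_divide_distrib[symmetric])
  ultimately show ?thesis
    unfolding convex_hull_3 using s assms
    by (intro CollectI exI[of _ "orient p b c / s"] exI[of _ "orient a p c / s"]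
        exI[of _ "orient a b p / s"]) auto
qed

text \<open>As \<open>\<epsilon> \<rightarrow> 0\<close> the image collapses onto the ray spanned by \<open>d\<close>; all requirements on the arms are
  strict inequalities that already hold in the limit.\<close>
definition flatten :: "real^2 \<Rightarrow> real^2 \<Rightarrow> real \<Rightarrow> real^2 \<Rightarrow> real^2" where
  "flatten d e \<epsilon> x = (x $ 1) *\<^sub>R d + (\<epsilon> * x $ 2) *\<^sub>R e"

lemma linear_flatten: "linear (flatten d e \<epsilon>)"
  by (rule linearI) (simp_all add: flatten_def algebra_simps)

lemma inj_flatten:
  assumes "\<epsilon> \<noteq> 0" "cross d e \<noteq> 0"
  shows "inj (flatten d e \<epsilon>)"
proof -
  have "x = 0" if "flatten d e \<epsilon> x = 0" for x
  proof -
    have "cross (flatten d e \<epsilon> x) e = x $ 1 * cross d e"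
      "cross d (flatten d e \<epsilon> x) = \<epsilon> * x $ 2 * cross d e"
      by (simp_all add: flatten_def cross_def algebra_simps)
    then show ?thesis using that assms by (simp add: cross_def vec_eq_iff forall_2)
  qed
  then show ?thesis by (simp add: linear_injective_0[OF linear_flatten])
qed

text \<open>The orientation is a polynomial in \<open>\<epsilon>\<close>, hence continuous at 0,
  where all points lie on their rays.\<close>

lemma tendsto_orient_flatten:
  "((\<lambda>\<epsilon>. orient (flatten d e \<epsilon> x) (flatten d' e' \<epsilon> y) (flatten d'' e'' \<epsilon> z)) \<longlongrightarrow>
    orient ((x $ 1) *\<^sub>R d) ((y $ 1) *\<^sub>R d') ((z $ 1) *\<^sub>R d'')) (at_right 0)"
proof -
  have "continuous_on UNIV (\<lambda>\<epsilon>. orient (flatten d e \<epsilon> x) (flatten d' e' \<epsilon> y) (flatten d'' e'' \<epsilon> z))"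
    unfolding orient_def cross_def flatten_def by (intro continuous_intros)
  then have "isCont (\<lambda>\<epsilon>. orient (flatten d e \<epsilon> x) (flatten d' e' \<epsilon> y) (flatten d'' e'' \<epsilon> z)) 0"
    by (simp add: continuous_on_eq_continuous_at)
  then show ?thesis
    unfolding isCont_def
    by (auto simp: flatten_def intro: tendsto_within_subset[where S = UNIV])
qed

lemma eventually_orient_flatten_pos:
  assumes "finite S"
    "\<And>x y z. (x, y, z) \<in> S \<Longrightarrow> orient ((x $ 1) *\<^sub>R d) ((y $ 1) *\<^sub>R d') ((z $ 1) *\<^sub>R d'') > 0"
  shows "\<forall>\<^sub>F \<epsilon> in at_right 0. \<forall>(x, y, z)\<in>S.
    orient (flatten d e \<epsilon> x) (flatten d' e' \<epsilon> y) (flatten d'' e'' \<epsilon> z) > 0"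
proof -
  have "\<forall>\<^sub>F \<epsilon> in at_right 0. case s of (x, y, z) \<Rightarrow>
      orient (flatten d e \<epsilon> x) (flatten d' e' \<epsilon> y) (flatten d'' e'' \<epsilon> z) > 0" if "s \<in> S" for s
    using that assms(2) order_tendstoD(1)[OF tendsto_orient_flatten] by (cases s) simp
  then show ?thesis using assms(1) by (intro eventually_ball_finite) auto
qed

text \<open>The limit values for two points on one ray and a third on another: the sign depends only
  on which of the two is farther out and on the turn between the rays.\<close>

lemma orient_scaled:
  "orient (u *\<^sub>R d) (v *\<^sub>R d') (u' *\<^sub>R d) = (u - u') * v * cross d d'"
  "orient (u *\<^sub>R d) (u' *\<^sub>R d) (v *\<^sub>R d') = (u - u') * v * cross d' d"
  by (simp_all add: orient_def cross_def algebra_simps)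

text \<open>The first coordinate becomes the position along the ray, so distinct positive values
  keep the limit orientations nonzero.\<close>

definition spread :: "(real^2) set \<Rightarrow> bool" where
  "spread P \<longleftrightarrow> inj_on (\<lambda>x. x $ 1) P \<and> (\<forall>x\<in>P. x $ 1 > 0)"

text \<open>The inner point \<open>f x\<close> lies on the inner side of the edge from the outer
  point \<open>f x'\<close> to the counterclockwise next arm; \<open>arm_prev\<close> treats the
  edge to the preceding arm.\<close>

definition arm_next where
  "arm_next f g X Y \<longleftrightarrow>
     (\<forall>x\<in>X. \<forall>x'\<in>X. \<forall>y\<in>Y. x $ 1 < x' $ 1 \<longrightarrow> orient (f x') (g y) (f x) > 0)"
  for f g :: "real^2 \<Rightarrow> real^2"

definition arm_prev where
  "arm_prev f g X Z \<longleftrightarrow>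
     (\<forall>x\<in>X. \<forall>x'\<in>X. \<forall>z\<in>Z. x $ 1 < x' $ 1 \<longrightarrow> orient (f x') (f x) (g z) > 0)"
  for f g :: "real^2 \<Rightarrow> real^2"

lemma eventually_arm_next:
  assumes "finite X" "finite Y" "spread X" "spread Y" "cross d d' > 0"
  shows "\<forall>\<^sub>F \<epsilon> in at_right 0. arm_next (flatten d e \<epsilon>) (flatten d' e' \<epsilon>) X Y"
proof -
  have "finite {(x', y, x). x' \<in> X \<and> y \<in> Y \<and> x \<in> X \<and> x $ 1 < x' $ 1}"
    by (rule finite_subset[of _ "X \<times> Y \<times> X"]) (use assms in auto)
  from eventually_orient_flatten_pos[OF this, of d d' d e e' e] show ?thesis
    using assms by (force simp: orient_scaled spread_def arm_next_def elim!: eventually_mono)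
qed

lemma eventually_arm_prev:
  assumes "finite X" "finite Z" "spread X" "spread Z" "cross d' d > 0"
  shows "\<forall>\<^sub>F \<epsilon> in at_right 0. arm_prev (flatten d e \<epsilon>) (flatten d' e' \<epsilon>) X Z"
proof -
  have "finite {(x', x, z). x' \<in> X \<and> x \<in> X \<and> z \<in> Z \<and> x $ 1 < x' $ 1}"
    by (rule finite_subset[of _ "X \<times> X \<times> Z"]) (use assms in auto)
  from eventually_orient_flatten_pos[OF this, of d d d' e e e'] show ?thesis
    using assms by (force simp: orient_scaled spread_def arm_prev_def elim!: eventually_mono)
qed

text \<open>A shear with generic parameter separates the first coordinates, and a translation makes
  them positive.\<close>

lemma ex_spread_affine_image:
  assumes "finite (P :: (real^2) set)"
  shows "\<exists>v L. linear L \<and> inj L \<and> spread ((\<lambda>x. v + L x) ` P)"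
proof -
  \<comment> \<open>These are the shear parameters at which two points would get equal first
    coordinates. Pairs with equal second coordinates only add the value 0, as division by zero gives
    0.\<close>
  define bad where "bad = (\<lambda>(x :: real^2, y). (y $ 1 - x $ 1) / (x $ 2 - y $ 2)) ` (P \<times> P)"
  have "finite bad" using assms by (simp add: bad_def)
  then obtain s where s: "s \<notin> bad" using ex_new_if_finite infinite_UNIV_char_0 by blast
  define L :: "real^2 \<Rightarrow> real^2" where "L x = vector [x $ 1 + s * x $ 2, x $ 2]" for x
  obtain m where m: "\<And>x. x \<in> P \<Longrightarrow> m < L x $ 1"
  proof -
    have "finite ((\<lambda>x. L x $ 1) ` P)" using assms by simp
    then have "bdd_below ((\<lambda>x. L x $ 1) ` P)" by simp
    then obtain l where "\<And>x. x \<in> P \<Longrightarrow> l \<le> L x $ 1" by (auto simp: bdd_below_def)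
    then show ?thesis using that[of "l - 1"] by force
  qed
  have lin: "linear L"
    by (rule linearI) (simp_all add: L_def vec_eq_iff forall_2 algebra_simps)
  have "inj L" by (auto simp: inj_def L_def vec_eq_iff forall_2)
  moreover have "x = y" if "x \<in> P" "y \<in> P" "L x $ 1 = L y $ 1" for x y
  proof (cases "x $ 2 = y $ 2")
    case True
    then show ?thesis using that by (simp add: L_def vec_eq_iff forall_2)
  next
    case False
    then have "s = (y $ 1 - x $ 1) / (x $ 2 - y $ 2)"
      using that by (simp add: L_def field_simps)
    then show ?thesis using s that by (auto simp: bad_def)
  qed
  ultimately have "spread ((\<lambda>x. vector [- m, 0] + L x) ` P)"
    using m unfolding spread_def by (force simp: inj_on_def)
  then show ?thesis using lin \<open>inj L\<close> by blast
qed

text \<open>The inner of two points of \<open>X\<close> lies in the triangle of the outer one and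
  any \<open>y\<close>, \<open>z\<close>: the three assumptions are the positivity of the three
  subtriangles.\<close>

lemma shielded_if_orient_pos:
  assumes inj: "inj_on (\<lambda>x. x $ 1) X"
    and pos: "\<And>x y z. x \<in> X \<Longrightarrow> y \<in> Y \<Longrightarrow> z \<in> Z \<Longrightarrow> orient (f x) (g y) (k z) > 0"
    and nxt: "arm_next f g X Y" and prev: "arm_prev f k X Z"
  shows "shielded (f ` X) (g ` Y) (k ` Z)"
proof -
  have "f x \<in> convex hull {f x', g y, k z}"
    if "x \<in> X" "x' \<in> X" "y \<in> Y" "z \<in> Z" "x $ 1 < x' $ 1" for x x' y z
    using that pos nxt prev unfolding arm_next_def arm_prev_def
    by (intro in_triangle_if_orient_pos) auto
  moreover have "x $ 1 < x' $ 1 \<or> x' $ 1 < x $ 1" if "x \<in> X" "x' \<in> X" "f x \<noteq> f x'" for x x'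
    using that inj by (metis inj_on_def linorder_neqE_linordered_idom)
  ultimately show ?thesis unfolding shielded_def by blast
qed

lemma disjoint_if_not_collinear:
  fixes A B C :: "(real^2) set"
  assumes "\<And>a b c. a \<in> A \<Longrightarrow> b \<in> B \<Longrightarrow> c \<in> C \<Longrightarrow> \<not> collinear {a, b, c}"
    and "A \<noteq> {}" "B \<noteq> {}" "C \<noteq> {}"
  shows "A \<inter> B = {}" "B \<inter> C = {}" "C \<inter> A = {}"
proof -
  have "a \<noteq> b" "b \<noteq> c" "c \<noteq> a" if "a \<in> A" "b \<in> B" "c \<in> C" for a b c
    using assms(1)[OF that] by (auto simp: insert_commute)
  then show "A \<inter> B = {}" "B \<inter> C = {}" "C \<inter> A = {}" using assms(2-4) by blast+
qed

lemma general_position_Un3: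
  assumes gp: "general_position A" "general_position B" "general_position C"
    and abc: "\<And>a b c. a \<in> A \<Longrightarrow> b \<in> B \<Longrightarrow> c \<in> C \<Longrightarrow> \<not> collinear {a, b, c}"
    and A: "\<And>x y z. x \<in> A \<Longrightarrow> y \<in> A \<Longrightarrow> z \<in> B \<union> C \<Longrightarrow> x \<noteq> y \<Longrightarrow> \<not> collinear {x, y, z}"
    and B: "\<And>x y z. x \<in> B \<Longrightarrow> y \<in> B \<Longrightarrow> z \<in> C \<union> A \<Longrightarrow> x \<noteq> y \<Longrightarrow> \<not> collinear {x, y, z}"
    and C: "\<And>x y z. x \<in> C \<Longrightarrow> y \<in> C \<Longrightarrow> z \<in> A \<union> B \<Longrightarrow> x \<noteq> y \<Longrightarrow> \<not> collinear {x, y, z}"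
  shows "general_position (A \<union> B \<union> C)"
  unfolding general_position_def
proof (intro ballI impI)
  fix x y z assume in_Un: "x \<in> A \<union> B \<union> C" "y \<in> A \<union> B \<union> C" "z \<in> A \<union> B \<union> C"
    and ne: "x \<noteq> y \<and> x \<noteq> z \<and> y \<noteq> z"
  have perms: "{y, x, z} = {x, y, z}" "{x, z, y} = {x, y, z}" "{y, z, x} = {x, y, z}"
    "{z, x, y} = {x, y, z}" "{z, y, x} = {x, y, z}" by auto
  have "\<not> collinear {x, y, z}" if "S \<in> {A, B, C}" "x \<in> S" "y \<in> S" "z \<in> S" for S
    using that ne gp by (auto simp: general_position_def)
  then have one: "\<not> collinear {x, y, z}"
    if "x \<in> A \<and> y \<in> A \<and> z \<in> A \<or> x \<in> B \<and> y \<in> B \<and> z \<in> B \<or> x \<in> C \<and> y \<in> C \<and> z \<in> C"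
    using that by blast
  show "\<not> collinear {x, y, z}"
    using in_Un ne one abc[of x y z] abc[of x z y] abc[of y x z] abc[of y z x] abc[of z x y]
      abc[of z y x] A[of x y z] A[of x z y] A[of y z x] B[of x y z] B[of x z y] B[of y z x]
      C[of x y z] C[of x z y] C[of y z x]
    unfolding perms by (elim UnE) simp_all
qed

text \<open>The strict orientation inequalities behind shielding also exclude collinear triples with
  exactly two points in one arm.\<close>

lemma not_collinear_arm:
  assumes inj: "inj_on (\<lambda>x. x $ 1) X"
    and nxt: "arm_next f g X Y" and prev: "arm_prev f k X Z"
    and xyz: "x \<in> f ` X" "y \<in> f ` X" "z \<in> g ` Y \<union> k ` Z" "x \<noteq> y"
  shows "\<not> collinear {x, y, z}"
proof -
  have less: "\<not> collinear {f s, f t, z}" if "s \<in> X" "t \<in> X" "s $ 1 < t $ 1" for s t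
  proof -
    have "orient (f t) z (f s) \<noteq> 0 \<or> orient (f t) (f s) z \<noteq> 0"
      using nxt prev xyz(3) that unfolding arm_next_def arm_prev_def by force
    then show ?thesis
      using orient_collinear[of "f t" z "f s"] orient_collinear[of "f t" "f s" z]
      by (auto simp: insert_commute)
  qed
  obtain s t where st: "s \<in> X" "t \<in> X" "x = f s" "y = f t" using xyz by blast
  then have "s $ 1 < t $ 1 \<or> t $ 1 < s $ 1"
    using inj xyz(4) by (metis inj_on_def linorder_neqE_linordered_idom)
  then show ?thesis using less[of s t] less[of t s] st by (auto simp: insert_commute)
qed

text \<open>After affine normalization each set is flattened onto its own ray; one small
  \<open>\<epsilon>\<close> serves finitely many strict inequalities at once.\<close>

lemma ex_economical_three_arms:
  assumes econ: "economical A" "economical B" "economical C"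
    and ne: "A \<noteq> {}" "B \<noteq> {}" "C \<noteq> {}"
    and balanced: "3 * 2 ^ (card A + card B) \<le> 10 * (5::nat) ^ card C"
      "3 * 2 ^ (card B + card C) \<le> 10 * (5::nat) ^ card A"
      "3 * 2 ^ (card C + card A) \<le> 10 * (5::nat) ^ card B"
  shows "\<exists>P. economical P \<and> card P = card A + card B + card C"
proof -
  have fin: "finite A" "finite B" "finite C" using econ by (simp_all add: economical_finite)
  have normal: "\<exists>P'. economical P' \<and> card P' = card P \<and> spread P'" if "economical P" for P
    using ex_spread_affine_image[OF economical_finite[OF that]] economical_affine_image[OF _ _ that]
    by metis
  obtain A' where A': "economical A'" "card A' = card A" "spread A'" using normal econ by blast
  obtain B' where B': "economical B'" "card B' = card B" "spread B'" using normal econ by blast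
  obtain C' where C': "economical C'" "card C' = card C" "spread C'" using normal econ by blast
  have fin': "finite A'" "finite B'" "finite C'"
    using A' B' C' by (simp_all add: economical_finite)
  have ne': "A' \<noteq> {}" "B' \<noteq> {}" "C' \<noteq> {}"
    using ne fin fin' A' B' C' by (metis card_0_eq)+
  \<comment> \<open>The directions sum to zero, so they positively span the plane, and each
    consecutive pair has determinant 1. The next direction serves as the transversal
    \<open>e\<close> of each arm.\<close>
  define d1 d2 d3 :: "real^2" where "d1 = vector [1, 0]" and "d2 = vector [0, 1]"
    and "d3 = vector [-1, -1]"
  have cross: "cross d1 d2 = 1" "cross d2 d3 = 1" "cross d3 d1 = 1"
    by (simp_all add: cross_def d1_def d2_def d3_def)
  let ?f = "flatten d1 d2" and ?g = "flatten d2 d3" and ?k = "flatten d3 d1"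
  have "\<forall>\<^sub>F \<epsilon> in at_right 0. \<forall>(x, y, z)\<in>A' \<times> B' \<times> C'. orient (?f \<epsilon> x) (?g \<epsilon> y) (?k \<epsilon> z) > 0"
  proof (rule eventually_orient_flatten_pos)
    fix x y z assume "(x, y, z) \<in> A' \<times> B' \<times> C'"
    then have pos: "x $ 1 > 0" "y $ 1 > 0" "z $ 1 > 0" using A' B' C' by (auto simp: spread_def)
    have "orient ((x $ 1) *\<^sub>R d1) ((y $ 1) *\<^sub>R d2) ((z $ 1) *\<^sub>R d3) =
        x $ 1 * y $ 1 + y $ 1 * z $ 1 + z $ 1 * x $ 1"
      by (simp add: orient_def cross_def d1_def d2_def d3_def algebra_simps)
    with pos show "orient ((x $ 1) *\<^sub>R d1) ((y $ 1) *\<^sub>R d2) ((z $ 1) *\<^sub>R d3) > 0"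
      by (simp add: add_pos_pos)
  qed (use fin' in auto)
  moreover note
    eventually_arm_next[OF fin'(1,2) A'(3) B'(3), of d1 d2 d2 d3]
    eventually_arm_next[OF fin'(2,3) B'(3) C'(3), of d2 d3 d3 d1]
    eventually_arm_next[OF fin'(3,1) C'(3) A'(3), of d3 d1 d1 d2]
    eventually_arm_prev[OF fin'(1,3) A'(3) C'(3), of d3 d1 d2 d1]
    eventually_arm_prev[OF fin'(2,1) B'(3) A'(3), of d1 d2 d3 d2]
    eventually_arm_prev[OF fin'(3,2) C'(3) B'(3), of d2 d3 d1 d3]
    eventually_at_right_less[of "0::real"]
  ultimately have "\<forall>\<^sub>F \<epsilon> in at_right (0::real). \<epsilon> > 0 \<and>
      (\<forall>(x, y, z)\<in>A' \<times> B' \<times> C'. orient (?f \<epsilon> x) (?g \<epsilon> y) (?k \<epsilon> z) > 0) \<and>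
      arm_next (?f \<epsilon>) (?g \<epsilon>) A' B' \<and> arm_next (?g \<epsilon>) (?k \<epsilon>) B' C' \<and> arm_next (?k \<epsilon>) (?f \<epsilon>) C' A' \<and>
      arm_prev (?f \<epsilon>) (?k \<epsilon>) A' C' \<and> arm_prev (?g \<epsilon>) (?f \<epsilon>) B' A' \<and> arm_prev (?k \<epsilon>) (?g \<epsilon>) C' B'"
    unfolding eventually_conj_iff using cross by simp
  from eventually_happens'[OF trivial_limit_at_right_real this] obtain \<epsilon> where \<epsilon>: "\<epsilon> > 0"
    and pos: "\<forall>(x, y, z)\<in>A' \<times> B' \<times> C'. orient (?f \<epsilon> x) (?g \<epsilon> y) (?k \<epsilon> z) > 0"
    and nxt: "arm_next (?f \<epsilon>) (?g \<epsilon>) A' B'" "arm_next (?g \<epsilon>) (?k \<epsilon>) B' C'" "arm_next (?k \<epsilon>) (?f \<epsilon>) C' A'"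
    and prev: "arm_prev (?f \<epsilon>) (?k \<epsilon>) A' C'" "arm_prev (?g \<epsilon>) (?f \<epsilon>) B' A'" "arm_prev (?k \<epsilon>) (?g \<epsilon>) C' B'"
    by blast
  have abc: "orient (?f \<epsilon> x) (?g \<epsilon> y) (?k \<epsilon> z) > 0" if "x \<in> A'" "y \<in> B'" "z \<in> C'" for x y z
    using pos that by auto
  let ?A = "?f \<epsilon> ` A'" and ?B = "?g \<epsilon> ` B'" and ?C = "?k \<epsilon> ` C'"
  have inj: "inj (?f \<epsilon>)" "inj (?g \<epsilon>)" "inj (?k \<epsilon>)" using inj_flatten cross \<epsilon> by auto
  have econ': "economical ?A" "economical ?B" "economical ?C"
    and card': "card ?A = card A" "card ?B = card B" "card ?C = card C"
    using economical_affine_image[OF linear_flatten inj(1) A'(1), of 0]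
      economical_affine_image[OF linear_flatten inj(2) B'(1), of 0]
      economical_affine_image[OF linear_flatten inj(3) C'(1), of 0] A'(2) B'(2) C'(2) by auto
  have bca: "orient (?g \<epsilon> y) (?k \<epsilon> z) (?f \<epsilon> x) > 0" if "y \<in> B'" "z \<in> C'" "x \<in> A'" for x y z
    using abc[OF that(3,1,2)] by (simp only: orient_rotate[of "?f \<epsilon> x"])
  have cab: "orient (?k \<epsilon> z) (?f \<epsilon> x) (?g \<epsilon> y) > 0" if "z \<in> C'" "x \<in> A'" "y \<in> B'" for x y z
    using abc[OF that(2,3,1)] by (simp only: orient_rotate[of "?k \<epsilon> z"])
  have h: "inj_on (\<lambda>x. x $ 1) A'" "inj_on (\<lambda>x. x $ 1) B'" "inj_on (\<lambda>x. x $ 1) C'"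
    using A' B' C' by (auto simp: spread_def)
  have shield: "shielded ?A ?B ?C" "shielded ?B ?C ?A" "shielded ?C ?A ?B"
    using shielded_if_orient_pos[OF h(1) abc nxt(1) prev(1)]
      shielded_if_orient_pos[OF h(2) bca nxt(2) prev(2)]
      shielded_if_orient_pos[OF h(3) cab nxt(3) prev(3)] by blast+
  have tri: "\<not> collinear {a, b, c}" if "a \<in> ?A" "b \<in> ?B" "c \<in> ?C" for a b c
    using that abc orient_collinear[of a b c] by fastforce
  have disj: "?A \<inter> ?B = {}" "?B \<inter> ?C = {}" "?C \<inter> ?A = {}"
    using disjoint_if_not_collinear[OF tri] ne' by simp_all
  have "general_position (?A \<union> ?B \<union> ?C)"
    using econ' tri not_collinear_arm[OF h(1) nxt(1) prev(1)]
      not_collinear_arm[OF h(2) nxt(2) prev(2)] not_collinear_arm[OF h(3) nxt(3) prev(3)]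
    by (intro general_position_Un3) (simp_all add: economical_def)
  then show ?thesis
    using economical_Un[OF econ' disj shield] balanced unfolding card' by blast
qed

section \<open>Recursion on the number of points and numerical estimates\<close>

text \<open>The claim reduces to \<open>12 * 4 ^ a \<le> 10 * 5 ^ a\<close>, which starts at
  \<open>a = 1\<close> with 48 against 50 and persists because 4 is less than 5.\<close>

lemma balanced_le:
  assumes "a \<ge> 1" "b + c \<le> 2 * a + 2"
  shows "3 * 2 ^ (b + c) \<le> 10 * (5::nat) ^ a"
proof -
  have "12 * (4::nat) ^ a \<le> 10 * 5 ^ a"
    using assms(1) by (induction a rule: dec_induct) auto
  moreover have "(2::nat) ^ (b + c) \<le> 2 ^ (2 * a + 2)"
    using assms(2) by (intro power_increasing) auto
  ultimately show ?thesis by (simp add: power_add power_mult)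
qed

lemma ex_economical: "n \<ge> 1 \<Longrightarrow> \<exists>P. economical P \<and> card P = n"
proof (induction n rule: less_induct)
  case (less n)
  show ?case
  proof (cases "n \<ge> 3")
    case True
    \<comment> \<open>The arm sizes differ by at most one, so any two of them sum to at most twice
      the third plus 2, as \<open>balanced_le\<close> demands.\<close>
    define a b c where "a = n div 3" and "b = (n - a) div 2" and "c = n - a - b"
    have "3 * a \<le> n" "n < 3 * a + 3" "2 * b \<le> n - a" "n - a < 2 * b + 2"
      unfolding a_def b_def by simp_all
    then have abc: "1 \<le> a" "a \<le> b" "b \<le> c" "c \<le> a + 1" "c < n" "a + b + c = n"
      using True unfolding c_def by simp_all
    obtain A B C where ABC: "economical A" "economical B" "economical C"
      "card A = a" "card B = b" "card C = c"
      using less.IH[of a] less.IH[of b] less.IH[of c] abc by auto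
    then have "\<exists>P. economical P \<and> card P = card A + card B + card C"
      using abc by (intro ex_economical_three_arms balanced_le) auto
    then show ?thesis using ABC abc by simp
  next
    case False
    \<comment> \<open>At most two points on the diagonal, so general position is vacuous. A single
      point gives equality \<open>10 = 5 * 2\<close> in the bound.\<close>
    define P :: "(real^2) set" where "P = (\<lambda>i. of_nat i) ` {..<n}"
    have card: "card P = n" and fin: "finite P"
      by (auto simp: P_def card_image inj_on_def)
    have "general_position P"
      unfolding general_position_def
    proof (intro ballI impI notI)
      fix x y z assume "x \<in> P" "y \<in> P" "z \<in> P" "x \<noteq> y \<and> x \<noteq> z \<and> y \<noteq> z"
      then have "{x, y, z} \<subseteq> P" "card {x, y, z} = 3" by auto
      then have "3 \<le> card P" using card_mono[OF fin] by metis
      then show False using card False by simp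
    qed
    moreover have "10 * card (peeling_sequences Q) \<le> 5 ^ card P * 2 ^ card Q"
      if "Q \<subseteq> P" "Q \<noteq> {}" for Q
    proof -
      have "finite Q" using that fin finite_subset by blast
      then have "card (peeling_sequences Q) \<le> fact (card Q)" "1 \<le> card Q" "card Q \<le> card P"
        using that fin card_peeling_sequences_le_fact
        by (auto simp: Suc_le_eq card_gt_0_iff card_mono)
      moreover have "card P = 1 \<or> card P = 2" using card False less.prems by auto
      ultimately show ?thesis
        by (auto simp: le_Suc_eq numeral_2_eq_2)
    qed
    ultimately show ?thesis using card fin unfolding economical_def by blast
  qed
qed

lemma fact_le_of_small:
  assumes "3 \<le> n" "n < 12"
  shows "fact n \<le> (12.29::real) ^ n / 100"
proof -
  have "n \<in> {3, 4, 5, 6, 7, 8, 9, 10, 11}" using assms by auto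
  then show ?thesis by (auto simp: fact_numeral power_divide divide_simps)
qed

text \<open>The inequality \<open>10 ^ (n + 1) \<le> 12.29 ^ n\<close> fails at 11 and holds from 12
  on, hence the separate treatment of smaller \<open>n\<close> by the factorial.\<close>

lemma ten_power_le:
  assumes "n \<ge> 12"
  shows "10 ^ n / 10 \<le> (12.29::real) ^ n / 100"
proof -
  have "10 * (10::real) ^ n \<le> 12.29 ^ n"
    using assms
  proof (induction n rule: dec_induct)
    case (step n)
    then have "10 * (10 * (10::real) ^ n) \<le> 12.29 * 12.29 ^ n" by (intro mult_mono) auto
    then show ?case by simp
  qed (simp add: power_divide)
  then show ?thesis by simp
qed

theorem theorem2:
  shows "(\<exists>c::real. c > 0 \<and>
            (\<forall>n::nat. n > 0 \<longrightarrow>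
              (\<forall>P::(real^2) set. finite P \<and> card P = n \<and> general_position P \<longrightarrow>
                 c * 3 ^ n \<le> real (card (peeling_sequences P))))) \<and>
         (\<forall>n::nat. n \<ge> 3 \<longrightarrow>
            (\<exists>P::(real^2) set. finite P \<and> card P = n \<and> general_position P \<and>
               real (card (peeling_sequences P)) \<le> 12.29 ^ n / 100))"
proof (intro conjI allI impI)
  show "\<exists>c::real. c > 0 \<and> (\<forall>n::nat. n > 0 \<longrightarrow>
      (\<forall>P::(real^2) set. finite P \<and> card P = n \<and> general_position P \<longrightarrow>
        c * 3 ^ n \<le> real (card (peeling_sequences P))))"
  proof (intro exI[of _ "1 / 9"] conjI allI impI)
    fix n :: nat and P :: "(real^2) set"
    assume "finite P \<and> card P = n \<and> general_position P"
    then have "3 ^ n \<le> 9 * card (peeling_sequences P)"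
      using card_peeling_sequences_lower by blast
    then have "real (3 ^ n) \<le> real (9 * card (peeling_sequences P))" by (rule of_nat_mono)
    then show "1 / 9 * 3 ^ n \<le> real (card (peeling_sequences P))" by simp
  qed simp
next
  fix n :: nat assume n: "n \<ge> 3"
  then obtain P where P: "economical P" "card P = n" using ex_economical[of n] by auto
  have "real (card (peeling_sequences P)) \<le> 12.29 ^ n / 100"
  proof (cases "n < 12")
    case True
    have "real (card (peeling_sequences P)) \<le> real (fact n)"
      using card_peeling_sequences_le_fact[of P] P
      by (metis economical_def of_nat_le_iff)
    then show ?thesis using fact_le_of_small[OF n True] by simp
  next
    case False
    have "P \<noteq> {}" using P n by auto
    then have "10 * card (peeling_sequences P) \<le> 5 ^ n * 2 ^ n"
      using P unfolding economical_def by blast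
    then have "real (10 * card (peeling_sequences P)) \<le> real (10 ^ n)"
      by (intro of_nat_mono) (simp flip: power_mult_distrib)
    then show ?thesis using ten_power_le[of n] False by simp
  qed
  then show "\<exists>P::(real^2) set. finite P \<and> card P = n \<and> general_position P \<and>
      real (card (peeling_sequences P)) \<le> 12.29 ^ n / 100"
    using P unfolding economical_def by blast
qed

end
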